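(* Let $\psi_0\in F$ be a fixed reference field, let $m,n\in\mathbb{N}_0$ be large enough indices such that the regularized master Dyson--Schwinger operator is a Hilbert--Schmidt operator $\mathbf{M}_{\psi_0}: H_m\otimes_{\mathrm{HS}}F_n\to H_0$, and let $\hat{\mathbf{M}}^2_{\psi_0}:H_m\to H_m$ be the associated positive trace class operator (all as defined in the context). Then for every real $T>0$ which is not smaller than the operator norm of $\hat{\mathbf{M}}^2_{\psi_0}$, the iteration $$G_0:=\mathbf{1},\qquad G_{k+1}:=G_k-T^{-1}\,\hat{\mathbf{M}}^2_{\psi_0}\,G_k\qquad(k\in\mathbb{N}_0)$$ converges in $H_m$; therefore the finite real number $\nu:=\lim_{k\to\infty}b\,G_k\in\mathbb{R}$ exists. The regularized MDS equation has solutions in $H_m$ (i.e. there exists $G\in H_m$ with $b\,G=1$ and $\mathbf{M}_{\psi_0}(G\otimes\delta\psi_T)=0$ for all $\delta\psi_T\in\mathbb{F}_T$) if and only if $\nu\neq0$. Moreover, if $\nu\neq0$, then $\frac1\nu\lim_{k\to\infty}G_k$ is a solution of the regularized MDS equation in $H_m$.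
   Context: **Fields.** $\mathcal{M}$ is a compact finite dimensional smooth oriented manifold, with or without boundary (if there is a boundary, it has the cone property). $F$ is the affine space of smooth sections of a real finite dimensional affine bundle over $\mathcal{M}$; $\mathbb{F}$ is the real vector space of smooth sections of the subordinate vector bundle, with its $C^\infty$ topology (a nuclear Fréchet space). $\mathbb{F}_T\subset\mathbb{F}$ is either $\mathbb{F}$ itself or the closed subspace of sections vanishing on $\partial\mathcal{M}$ together with all derivatives. There is a real-complex splitting $\mathbb{F}=\mathbb{F}_r\oplus\mathbb{F}_c$ into closed subspaces with $\mathbb{F}_c$ carrying a complex structure; $\mathbb{F}_{(\mathbb{C})}:=(\mathbb{F}_r\otimes\mathbb{C})\oplus\mathbb{F}_c$, which contains $\mathbb{F}$ as a real subspace. There is a splitting $\mathbb{F}=\bigoplus_{i=1}^f\mathbb{F}_i$ into closed flavor sectors, each contained in $\mathbb{F}_r$ or in $\mathbb{F}_c$, with labels $s_i\in\{0,1\}$ (bosonic/fermionic). $\mathbb{F}_T$ respects these splittings. **Field algebra.** Both $\mathbb{F}_{(\mathbb{C})}$ and $\mathbb{F}_T$ are countably Hilbert nuclear Fréchet spaces: their topologies are defined by sequences $\|\cdot\|_0,\|\cdot\|_1,\dots$, respectively $\|\cdot\|^F_0,\|\cdot\|^F_1,\dots$, of increasing Hilbertian norms of Sobolev type, such that the completions are nested in each other and the inclusions between distant enough completions are Hilbert--Schmidt (and eventually nuclear). $F_n$ denotes the Hilbert space completion of $\mathbb{F}_T$ in $\|\cdot\|^F_n$. The analytic tensor algebra $\mathcal{T}_h(\mathbb{F}_{(\mathbb{C})})$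 is the space of sequences $G=(G^{(0)},G^{(1)},\dots)$ with $G^{(n)}\in\bigotimes^n\mathbb{F}_{(\mathbb{C})}$ (completed tensor products) for which all of the norms $\|G\|_m:=\big(\sum_{n\ge0}2^{mn}(\|G^{(n)}\|_m^{\otimes n})^2\big)^{1/2}$, $m\in\mathbb{N}_0$, are finite, with the topology defined by these norms, where $\|\cdot\|_m^{\otimes n}$ is the Hilbertian cross norm. A permutation $\pi$ of $n$ symbols acts on $\bigotimes^n\mathbb{F}_{(\mathbb{C})}$ by $U_\pi(x_1\otimes\cdots\otimes x_n)=(-1)^{\sum_i s_i\sigma_i(\pi)}x_{\pi(1)}\otimes\cdots\otimes x_{\pi(n)}$ when each $x_j$ lies in a single flavor sector, where $\sigma_i(\pi)\in\{0,1\}$ is the parity of the permutation among the factors lying in the $i$-th sector. Let $P^{\mathrm{sym}}_n=\frac1{n!}\sum_\pi U_\pi$. The field algebra is the closed subspace $\mathcal{H}:=A(\mathbb{F}_{(\mathbb{C})})\subset\mathcal{T}_h(\mathbb{F}_{(\mathbb{C})})$ of all $G$ with $P^{\mathrm{sym}}_nG^{(n)}=G^{(n)}$ for all $n$; it is again a countably Hilbert nuclear Fréchet space. $H_m$ is the Hilbert space completion of $\mathcal{H}$ in $\|\cdot\|_m$, with scalar product $\langle\cdot,\cdot\rangle_m$. $\mathbf{1}:=(1,0,0,\dots)$, and $b\,G:=G^{(0)}$ is the (continuous) scalar component map, so that $b\,G=\langle\mathbf{1},G\rangle_m$. **Regularized MDS operator.** $\hbar$ is a fixed real number. $E:F\times\mathbb{F}_T\to\mathbb{R}$,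 $(\psi,\delta\psi_T)\mapsto(E(\psi)|\delta\psi_T)$ is an Euler--Lagrange functional of a classical field theory: it is jointly sequentially continuous and linear in the second variable. It is assumed that there is an element $\mathbf{E}_{\psi_0}\in\mathcal{H}^*\otimes\mathbb{F}_T^*$ (${}^*$ = strong dual) with $(E(\psi)|\delta\psi_T)=\big(\mathbf{E}_{\psi_0}\,\big|\,(1,\psi-\psi_0,\bigotimes^2(\psi-\psi_0),\dots)\otimes\delta\psi_T\big)$ for all $\psi\in F$, $\delta\psi_T\in\mathbb{F}_T$ (this includes the multipolynomial functionals). Contracting the last entry with $\delta\psi_T$ gives $(\mathbf{E}_{\psi_0}|\delta\psi_T)\in\mathcal{H}^*$. For $p=(p^{(0)},p^{(1)},\dots)\in\mathcal{H}^*$, the left insertion operator $\iota_p$ is the continuous linear operator on $\mathcal{H}$ with $(\iota_pG)^{(n)}=\sum_k\big(p^{(k)}\text{ contracted with the first }k\text{ tensor entries of }G^{(n+k)}\big)$. For $u\in\mathbb{F}_{(\mathbb{C})}$, $L_u$ is the left multiplication operator on $\mathcal{H}$, $(L_uG)^{(n+1)}=(n+1)P^{\mathrm{sym}}_{n+1}(u\otimes G^{(n)})$, $(L_uG)^{(0)}=0$. $\kappa$ is a fixed mollifying kernel, i.e. $C_\kappa:\mathbb{F}\to\mathbb{F}$ is an integral operator with smooth properly supported kernel (a properly supported smoothing operator) preserving the flavor sectors. The regularized MDS operator is the continuous linear map $\mathbf{M}_{\psi_0}:\mathcal{H}\otimes\mathbb{F}_T\to\mathcal{H}$, $\mathbf{M}_{\psi_0}(G\otimes\delta\psi_T)=\big(\iota_{(\mathbf{E}_{\psi_0}|\delta\psi_T)}-\mathrm{i}\hbar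 L_{C_\kappa\delta\psi_T}\big)G$. **Hilbert space version.** For all large enough $m,n$, $\mathbf{M}_{\psi_0}$ extends continuously to a Hilbert--Schmidt operator $H_m\otimes_{\mathrm{HS}}F_n\to H_0$, denoted by the same symbol ($\otimes_{\mathrm{HS}}$ = Hilbert--Schmidt, i.e. Hilbert space, tensor product); such $m,n$ are fixed. For an orthonormal basis $(e_i)_{i\in I}$ of $F_n$, the form $B(G_1,G_2)=\sum_{i\in I}\langle\mathbf{M}_{\psi_0}(G_1\otimes e_i),\mathbf{M}_{\psi_0}(G_2\otimes e_i)\rangle_{H_0}$ is a continuous positive semidefinite sesquilinear form on $H_m$ which is independent of the basis, and $\hat{\mathbf{M}}^2_{\psi_0}:H_m\to H_m$ is the unique continuous linear operator with $B(G_1,G_2)=\langle G_1,\hat{\mathbf{M}}^2_{\psi_0}G_2\rangle_m$ for all $G_1,G_2\in H_m$; it is positive and trace class. *)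

theory Defs
  imports "HOL-Analysis.Analysis" "HOL-Combinatorics.Permutations"
begin

section \<open>Complex Hilbert spaces\<close>

class complex_vector = real_vector +
  fixes scaleC :: "complex \<Rightarrow> 'a \<Rightarrow> 'a"  (infixr "*\<^sub>C" 75)
  assumes scaleC_add_right: "c *\<^sub>C (x + y) = c *\<^sub>C x + c *\<^sub>C y"
    and scaleC_add_left: "(c + d) *\<^sub>C x = c *\<^sub>C x + d *\<^sub>C x"
    and scaleC_scaleC: "c *\<^sub>C d *\<^sub>C x = (c * d) *\<^sub>C x"
    and scaleC_of_real: "complex_of_real r *\<^sub>C x = r *\<^sub>R x"

text \<open>The scalar product is antilinear in its first argument. Its real part is the real inner
  product, so norm, topology and operator norm are those of the underlying real Hilbert space.\<close>

class complex_hilbert = complex_vector + real_inner + complete_space +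
  fixes cinner :: "'a \<Rightarrow> 'a \<Rightarrow> complex"
  assumes cinner_commute: "cinner y x = cnj (cinner x y)"
    and cinner_add_right: "cinner x (y + z) = cinner x y + cinner x z"
    and cinner_scaleC_right: "cinner x (c *\<^sub>C y) = c * cinner x y"
    and Re_cinner: "Re (cinner x y) = inner x y"

instantiation complex :: complex_hilbert
begin

definition scaleC_complex :: "complex \<Rightarrow> complex \<Rightarrow> complex"
  where "scaleC_complex c x = c * x"

definition cinner_complex :: "complex \<Rightarrow> complex \<Rightarrow> complex"
  where "cinner_complex x y = cnj x * y"

instance
  by standard
    (simp_all add: scaleC_complex_def cinner_complex_def algebra_simps scaleR_conv_of_real
      inner_complex_def)

end

abbreviation cspan :: "'a::complex_vector set \<Rightarrow> 'a set"
  where "cspan \<equiv> module.span scaleC"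

definition csubspace :: "'a::complex_vector set \<Rightarrow> bool"
  where "csubspace V \<longleftrightarrow>
    0 \<in> V \<and> (\<forall>x\<in>V. \<forall>y\<in>V. x + y \<in> V) \<and> (\<forall>c. \<forall>x\<in>V. c *\<^sub>C x \<in> V)"

definition clinear_on ::
    "'a::complex_vector set \<Rightarrow> ('a \<Rightarrow> 'b::complex_vector) \<Rightarrow> bool"
  where "clinear_on V f \<longleftrightarrow>
    (\<forall>x\<in>V. \<forall>y\<in>V. f (x + y) = f x + f y) \<and> (\<forall>c. \<forall>x\<in>V. f (c *\<^sub>C x) = c *\<^sub>C f x)"

definition rlinear_on :: "'a::real_vector set \<Rightarrow> ('a \<Rightarrow> 'b::real_vector) \<Rightarrow> bool"
  where "rlinear_on V f \<longleftrightarrow>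
    (\<forall>x\<in>V. \<forall>y\<in>V. f (x + y) = f x + f y) \<and> (\<forall>c. \<forall>x\<in>V. f (c *\<^sub>R x) = c *\<^sub>R f x)"

definition bounded_clinear :: "('a::complex_hilbert \<Rightarrow> 'b::complex_hilbert) \<Rightarrow> bool"
  where "bounded_clinear f \<longleftrightarrow> clinear_on UNIV f \<and> bounded_linear f"

definition orthonormal_set :: "'a::real_inner set \<Rightarrow> bool"
  where "orthonormal_set E \<longleftrightarrow> pairwise orthogonal E \<and> (\<forall>e\<in>E. norm e = 1)"

definition real_hilbert_basis :: "'a::{real_inner,complete_space} set \<Rightarrow> bool"
  where "real_hilbert_basis E \<longleftrightarrow> orthonormal_set E \<and> closure (span E) = UNIV"

definition complex_hilbert_basis :: "'a::complex_hilbert set \<Rightarrow> bool"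
  where "complex_hilbert_basis E \<longleftrightarrow>
    (\<forall>e\<in>E. \<forall>e'\<in>E. cinner e e' = (if e = e' then 1 else 0)) \<and> closure (cspan E) = UNIV"

definition hilbert_schmidt :: "('a::complex_hilbert \<Rightarrow> 'b::complex_hilbert) \<Rightarrow> bool"
  where "hilbert_schmidt M \<longleftrightarrow> bounded_clinear M \<and>
    (\<forall>E. complex_hilbert_basis E \<longrightarrow> (\<lambda>e. (norm (M e))\<^sup>2) summable_on E)"

text \<open>\<open>'c\<close> together with the bilinear map \<open>tp\<close> is a Hilbert space tensor product of the complex
  Hilbert space \<open>'a\<close> and the real Hilbert space \<open>'b\<close>; this determines it up to unitary isomorphism.\<close>

definition hilbert_tensor_product ::
    "('a::complex_hilbert \<Rightarrow> 'b::{real_inner,complete_space} \<Rightarrow> 'c::complex_hilbert) \<Rightarrow> bool"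
  where "hilbert_tensor_product tp \<longleftrightarrow>
    (\<forall>x. clinear_on UNIV (\<lambda>G. tp G x)) \<and> (\<forall>G. linear (tp G)) \<and>
    (\<forall>G x G' x'. cinner (tp G x) (tp G' x') = cinner G G' * complex_of_real (inner x x')) \<and>
    closure (cspan {tp G x | G x. True}) = UNIV"


section \<open>Smooth maps\<close>

text \<open>Iterated directional derivatives. On an open set of a finite dimensional space, a map is
  smooth iff all of them are (Frechet) differentiable.\<close>

definition dderiv ::
    "'a list \<Rightarrow> ('a::real_normed_vector \<Rightarrow> 'b::real_normed_vector) \<Rightarrow> 'a \<Rightarrow> 'b"
  where "dderiv vs f = foldr (\<lambda>v g x. frechet_derivative g (at x) v) vs f"

text \<open>Smoothness on an arbitrary set, by smooth local extension; used on relatively open subsets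
  of half-spaces.\<close>

definition smooth_on ::
    "'a::real_normed_vector set \<Rightarrow> ('a \<Rightarrow> 'b::real_normed_vector) \<Rightarrow> bool"
  where "smooth_on S f \<longleftrightarrow>
    (\<forall>x\<in>S. \<exists>U g. open U \<and> x \<in> U \<and> (\<forall>vs. \<forall>y\<in>U. dderiv vs g differentiable (at y)) \<and>
      (\<forall>y\<in>S \<inter> U. g y = f y))"

definition det_wrt :: "'a::real_inner set \<Rightarrow> ('a \<Rightarrow> 'a) \<Rightarrow> real"
  where "det_wrt B L = (\<Sum>p | p permutes B. of_int (sign p) * (\<Prod>b\<in>B. inner (p b) (L b)))"

text \<open>Lebesgue measure of a finite dimensional inner product space with orthonormal basis \<open>B\<close>.
  Unlike \<^const>\<open>lborel\<close> it does not exclude dimension 0.\<close>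

definition lebesgue_wrt :: "'a::real_inner set \<Rightarrow> 'a measure"
  where "lebesgue_wrt B =
    distr (Pi\<^sub>M B (\<lambda>_. lborel :: real measure)) borel (\<lambda>g. \<Sum>b\<in>B. g b *\<^sub>R b)"


section \<open>Compact oriented manifolds with boundary\<close>

text \<open>The manifold is the whole (compact Hausdorff) type \<open>'p\<close>. Charts take values in a finite
  dimensional space \<open>'v\<close> with orthonormal basis \<open>frame\<close>.\<close>

record ('i, 'p, 'v) atlas =
  frame :: "'v set"
  patch :: "'i \<Rightarrow> 'p set"
  chart :: "'i \<Rightarrow> 'p \<Rightarrow> 'v"

definition image_of :: "('i, 'p, 'v, 'z) atlas_scheme \<Rightarrow> 'i \<Rightarrow> 'v set"
  where "image_of D i = chart D i ` patch D i"

definition param :: "('i, 'p, 'v, 'z) atlas_scheme \<Rightarrow> 'i \<Rightarrow> 'v \<Rightarrow> 'p"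
  where "param D i = inv_into (patch D i) (chart D i)"

text \<open>For \<open>e = 0\<close> this is the whole space, which gives charts without boundary points. Half-spaces
  in both directions are needed for oriented manifolds of dimension 1.\<close>

definition half_space :: "'v::real_inner \<Rightarrow> 'v set"
  where "half_space e = {x. 0 \<le> inner e x}"

text \<open>Being modelled on half-spaces, the boundary automatically has the cone property.\<close>

definition compact_oriented_manifold ::
    "('i, 'p::t2_space, 'v::real_inner, 'z) atlas_scheme \<Rightarrow> bool"
  where "compact_oriented_manifold D \<longleftrightarrow>
    finite (frame D) \<and> orthonormal_set (frame D) \<and> span (frame D) = UNIV \<and>
    compact (UNIV :: 'p set) \<and> (\<Union>i. patch D i) = UNIV \<and>
    (\<forall>i. open (patch D i) \<and>
      homeomorphism (patch D i) (image_of D i) (chart D i) (param D i) \<and>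
      (\<exists>e. openin (top_of_set (half_space e)) (image_of D i))) \<and>
    (\<forall>i j. smooth_on (chart D j ` (patch D i \<inter> patch D j)) (\<lambda>x. chart D i (param D j x))) \<and>
    (\<forall>i j. \<forall>x \<in> interior (chart D j ` (patch D i \<inter> patch D j)).
      0 < det_wrt (frame D) (frechet_derivative (\<lambda>x. chart D i (param D j x)) (at x)))"

definition manifold_boundary :: "('i, 'p, 'v::real_inner, 'z) atlas_scheme \<Rightarrow> 'p set"
  where "manifold_boundary D =
    {p. \<exists>i. p \<in> patch D i \<and> chart D i p \<notin> interior (image_of D i)}"

text \<open>A measure with smooth positive density in every chart.\<close>

definition volume_measure ::
    "('i, 'p::t2_space, 'v::real_inner, 'z) atlas_scheme \<Rightarrow> 'p measure \<Rightarrow> bool"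
  where "volume_measure D \<mu> \<longleftrightarrow> sets \<mu> = sets borel \<and>
    (\<forall>i. \<exists>d :: 'v \<Rightarrow> real. smooth_on (image_of D i) d \<and> (\<forall>x\<in>image_of D i. 0 < d x) \<and>
      (\<forall>X\<in>sets borel. X \<subseteq> patch D i \<longrightarrow>
        emeasure \<mu> X =
          (\<integral>\<^sup>+x. ennreal (d x) * indicator (chart D i ` X) x \<partial>lebesgue_wrt (frame D))))"


section \<open>Affine bundles and their sections\<close>

text \<open>A bundle with typical fibre \<open>'w\<close> is presented by its transition functions over an atlas whose
  patches trivialize it: over \<open>patch i \<inter> patch j\<close>, fibre coordinate \<open>w\<close> with respect to \<open>j\<close> is
  fibre coordinate \<open>trans_lin i j p w + trans_off i j p\<close> with respect to \<open>i\<close>. The linear parts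
  present the subordinate vector bundle. A section is the family of its local representatives,
  extended by 0.\<close>

record ('i, 'p, 'v, 'w) bundle_data = "('i, 'p, 'v) atlas" +
  trans_lin :: "'i \<Rightarrow> 'i \<Rightarrow> 'p \<Rightarrow> 'w \<Rightarrow> 'w"
  trans_off :: "'i \<Rightarrow> 'i \<Rightarrow> 'p \<Rightarrow> 'w"

definition affine_bundle ::
    "('i, 'p::t2_space, 'v::real_inner, 'w::real_normed_vector, 'z) bundle_data_scheme \<Rightarrow> bool"
  where "affine_bundle D \<longleftrightarrow>
    (\<exists>S. finite S \<and> span S = (UNIV :: 'w set)) \<and>
    (\<forall>i j. \<forall>p \<in> patch D i \<inter> patch D j. linear (trans_lin D i j p)) \<and>
    (\<forall>i. \<forall>p \<in> patch D i. trans_lin D i i p = id \<and> trans_off D i i p = 0) \<and>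
    (\<forall>i j k. \<forall>p \<in> patch D i \<inter> patch D j \<inter> patch D k.
      trans_lin D i k p = trans_lin D i j p \<circ> trans_lin D j k p \<and>
      trans_off D i k p = trans_lin D i j p (trans_off D j k p) + trans_off D i j p) \<and>
    (\<forall>i j. smooth_on (chart D j ` (patch D i \<inter> patch D j))
        (\<lambda>x. trans_off D i j (param D j x)) \<and>
      (\<forall>w. smooth_on (chart D j ` (patch D i \<inter> patch D j))
        (\<lambda>x. trans_lin D i j (param D j x) w)))"

definition affine_sections ::
    "('i, 'p, 'v::real_inner, 'w::real_normed_vector, 'z) bundle_data_scheme \<Rightarrow> ('i \<Rightarrow> 'p \<Rightarrow> 'w) set"
  where "affine_sections D = {s.
    (\<forall>i. smooth_on (image_of D i) (\<lambda>x. s i (param D i x))) \<and>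
    (\<forall>i j. \<forall>p \<in> patch D i \<inter> patch D j.
      s i p = trans_lin D i j p (s j p) + trans_off D i j p) \<and>
    (\<forall>i p. p \<notin> patch D i \<longrightarrow> s i p = 0)}"

definition vector_sections ::
    "('i, 'p, 'v::real_inner, 'w::real_normed_vector, 'z) bundle_data_scheme \<Rightarrow> ('i \<Rightarrow> 'p \<Rightarrow> 'w) set"
  where "vector_sections D = {s.
    (\<forall>i. smooth_on (image_of D i) (\<lambda>x. s i (param D i x))) \<and>
    (\<forall>i j. \<forall>p \<in> patch D i \<inter> patch D j. s i p = trans_lin D i j p (s j p)) \<and>
    (\<forall>i p. p \<notin> patch D i \<longrightarrow> s i p = 0)}"

text \<open>Convergence to 0 in the \<open>C\<^sup>\<infinity>\<close> topology. Derivatives are evaluated at interior points of the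
  chart image only, from where they extend continuously to the boundary. All topologies on
  spaces of sections are metrizable, so they are determined by their null sequences.\<close>

definition section_null ::
    "('i, 'p, 'v::real_inner, 'w::real_normed_vector, 'z) bundle_data_scheme \<Rightarrow>
      (nat \<Rightarrow> 'i \<Rightarrow> 'p \<Rightarrow> 'w) \<Rightarrow> bool"
  where "section_null D X \<longleftrightarrow>
    (\<forall>i K vs. compact K \<and> K \<subseteq> image_of D i \<longrightarrow>
      uniform_limit (K \<inter> interior (image_of D i))
        (\<lambda>k. dderiv vs (\<lambda>x. X k i (param D i x))) (\<lambda>_. 0) sequentially)"

definition flat_on_boundary ::
    "('i, 'p, 'v::real_inner, 'w::real_normed_vector, 'z) bundle_data_scheme \<Rightarrow>
      ('i \<Rightarrow> 'p \<Rightarrow> 'w) \<Rightarrow> bool"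
  where "flat_on_boundary D s \<longleftrightarrow>
    (\<forall>p \<in> manifold_boundary D. \<forall>i vs. p \<in> patch D i \<longrightarrow>
      (dderiv vs (\<lambda>x. s i (param D i x)) \<longlongrightarrow> 0)
        (at (chart D i p) within interior (image_of D i)))"

text \<open>\<open>C\<close> acts on vector bundle sections, via the linear bijection \<open>r\<close> onto these, as the integral
  operator with a smooth kernel. The kernel maps the fibre at \<open>q\<close> to the fibre at \<open>p\<close>, and
  \<open>k i j p q\<close> is its expression in the trivializations \<open>i\<close> at \<open>p\<close> and \<open>j\<close> at \<open>q\<close>; the integrand
  does not depend on the choice of \<open>j\<close>. On a compact manifold every kernel is properly
  supported.\<close>

definition smoothing_operator ::
    "('i, 'p::t2_space, 'v::real_inner, 'w::{banach,second_countable_topology}, 'z) bundle_data_scheme \<Rightarrow>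
      ('f \<Rightarrow> 'i \<Rightarrow> 'p \<Rightarrow> 'w) \<Rightarrow> ('f \<Rightarrow> 'f) \<Rightarrow> bool"
  where "smoothing_operator D r C \<longleftrightarrow>
    (\<exists>\<mu> k. volume_measure D \<mu> \<and>
      (\<forall>i j. \<forall>p \<in> patch D i. \<forall>q \<in> patch D j. linear (k i j p q)) \<and>
      (\<forall>i i' j j'. \<forall>p \<in> patch D i \<inter> patch D i'. \<forall>q \<in> patch D j \<inter> patch D j'.
        k i' j' p q = trans_lin D i' i p \<circ> k i j p q \<circ> trans_lin D j j' q) \<and>
      (\<forall>i j w. smooth_on (image_of D i \<times> image_of D j)
        (\<lambda>(x, y). k i j (param D i x) (param D j y) w)) \<and>
      (\<forall>f i. \<forall>p \<in> patch D i.
        r (C f) i p = (\<integral>q. (let j = (SOME j. q \<in> patch D j) in k i j p q (r f j q)) \<partial>\<mu>)))"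


section \<open>Fields\<close>

text \<open>\<open>'f\<close> is the space of smooth sections of the vector bundle, identified with the concrete
  sections through \<open>rep\<close>. \<open>'x\<close> is its partial complexification, containing \<open>'f\<close> through
  \<open>emb\<close>. \<open>Jc\<close> is the complex structure of the complex part \<open>Fc\<close>.\<close>

record ('i, 'p, 'v, 'w, 'f, 'x) fields = "('i, 'p, 'v, 'w) bundle_data" +
  rep :: "'f \<Rightarrow> 'i \<Rightarrow> 'p \<Rightarrow> 'w"
  FT :: "'f set"
  Fr :: "'f set"
  Fc :: "'f set"
  Jc :: "'f \<Rightarrow> 'f"
  num_sectors :: nat
  sector :: "nat \<Rightarrow> 'f set"
  spin :: "nat \<Rightarrow> nat"
  emb :: "'f \<Rightarrow> 'x"
  ipC :: "nat \<Rightarrow> 'x \<Rightarrow> 'x \<Rightarrow> complex"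
  ipT :: "nat \<Rightarrow> 'f \<Rightarrow> 'f \<Rightarrow> real"

definition field_null ::
    "('i, 'p, 'v::real_inner, 'w::real_normed_vector, 'f, 'x, 'z) fields_scheme \<Rightarrow>
      (nat \<Rightarrow> 'f) \<Rightarrow> bool"
  where "field_null D X \<longleftrightarrow> section_null D (\<lambda>k. rep D (X k))"

definition closed_subspace ::
    "('i, 'p, 'v::real_inner, 'w::real_normed_vector, 'f::real_vector, 'x, 'z) fields_scheme \<Rightarrow>
      'f set \<Rightarrow> bool"
  where "closed_subspace D V \<longleftrightarrow> subspace V \<and>
    (\<forall>X f. (\<forall>k. X k \<in> V) \<and> field_null D (\<lambda>k. X k - f) \<longrightarrow> f \<in> V)"

definition field_space ::
    "('i, 'p::t2_space, 'v::real_inner, 'w::real_normed_vector, 'f::real_vector, 'x, 'z)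
      fields_scheme \<Rightarrow> bool"
  where "field_space D \<longleftrightarrow>
    inj (rep D) \<and> range (rep D) = vector_sections D \<and>
    (\<forall>f g i p. rep D (f + g) i p = rep D f i p + rep D g i p) \<and>
    (\<forall>c f i p. rep D (c *\<^sub>R f) i p = c *\<^sub>R rep D f i p) \<and>
    (FT D = UNIV \<or> FT D = {f. flat_on_boundary D (rep D f)})"

definition real_complex_splitting ::
    "('i, 'p, 'v::real_inner, 'w::real_normed_vector, 'f::real_vector, 'x, 'z) fields_scheme \<Rightarrow> bool"
  where "real_complex_splitting D \<longleftrightarrow>
    closed_subspace D (Fr D) \<and> closed_subspace D (Fc D) \<and> Fr D \<inter> Fc D = {0} \<and>
    (\<forall>f. \<exists>r\<in>Fr D. \<exists>c\<in>Fc D. f = r + c) \<and>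
    (\<forall>r\<in>Fr D. \<forall>c\<in>Fc D. r + c \<in> FT D \<longrightarrow> r \<in> FT D \<and> c \<in> FT D) \<and>
    rlinear_on (Fc D) (Jc D) \<and> (\<forall>c\<in>Fc D. Jc D c \<in> Fc D \<and> Jc D (Jc D c) = - c) \<and>
    (\<forall>X. (\<forall>k. X k \<in> Fc D) \<and> field_null D X \<longrightarrow> field_null D (\<lambda>k. Jc D (X k)))"

text \<open>Sectors contained in \<open>Fc\<close> are complex subspaces; otherwise the permutation action on complex
  tensor powers would not be well defined.\<close>

definition flavor_splitting ::
    "('i, 'p, 'v::real_inner, 'w::real_normed_vector, 'f::real_vector, 'x, 'z) fields_scheme \<Rightarrow> bool"
  where "flavor_splitting D \<longleftrightarrow>
    (\<forall>l<num_sectors D. closed_subspace D (sector D l) \<and> spin D l \<in> {0, 1} \<and>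
      (sector D l \<subseteq> Fr D \<or> sector D l \<subseteq> Fc D \<and> Jc D ` sector D l \<subseteq> sector D l)) \<and>
    (\<forall>f. \<exists>!c. (\<forall>l<num_sectors D. c l \<in> sector D l) \<and> (\<forall>l\<ge>num_sectors D. c l = 0) \<and>
      f = (\<Sum>l<num_sectors D. c l)) \<and>
    (\<forall>c. (\<forall>l<num_sectors D. c l \<in> sector D l) \<and> (\<Sum>l<num_sectors D. c l) \<in> FT D \<longrightarrow>
      (\<forall>l<num_sectors D. c l \<in> FT D))"

text \<open>\<open>'x = (Fr \<otimes> \<complex>) \<oplus> Fc\<close>.\<close>

definition partial_complexification ::
    "('i, 'p, 'v, 'w, 'f::real_vector, 'x::complex_vector, 'z) fields_scheme \<Rightarrow> bool"
  where "partial_complexification D \<longleftrightarrow>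
    linear (emb D) \<and>
    (\<forall>x. \<exists>!(f, r). r \<in> Fr D \<and> x = emb D f + \<i> *\<^sub>C emb D r) \<and>
    (\<forall>c\<in>Fc D. emb D (Jc D c) = \<i> *\<^sub>C emb D c)"

definition complex_field_null ::
    "('i, 'p, 'v::real_inner, 'w::real_normed_vector, 'f::real_vector, 'x::complex_vector, 'z)
      fields_scheme \<Rightarrow> (nat \<Rightarrow> 'x) \<Rightarrow> bool"
  where "complex_field_null D X \<longleftrightarrow>
    (\<exists>f r. field_null D f \<and> field_null D r \<and>
      (\<forall>k. r k \<in> Fr D \<and> X k = emb D (f k) + \<i> *\<^sub>C emb D (r k)))"

definition complex_sector ::
    "('i, 'p, 'v, 'w, 'f, 'x::complex_vector, 'z) fields_scheme \<Rightarrow> nat \<Rightarrow> 'x set"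
  where "complex_sector D l = cspan (emb D ` sector D l)"


section \<open>Countably Hilbert nuclear spaces\<close>

text \<open>An increasing sequence of scalar products on \<open>V\<close>, such that the canonical maps between the
  completions are injective and, for distant enough indices, Hilbert-Schmidt (hence eventually
  nuclear). The Hilbert-Schmidt condition is the uniform bound on finite orthonormal families,
  which may be taken from the dense subspace \<open>V\<close>.\<close>

definition countably_hilbert ::
    "'a::real_vector set \<Rightarrow> (nat \<Rightarrow> 'a \<Rightarrow> 'a \<Rightarrow> real) \<Rightarrow> bool"
  where "countably_hilbert V ip \<longleftrightarrow> subspace V \<and>
    (\<forall>k. \<forall>x\<in>V. \<forall>y\<in>V. ip k x y = ip k y x) \<and>
    (\<forall>k. \<forall>x\<in>V. rlinear_on V (ip k x)) \<and>
    (\<forall>k. \<forall>x\<in>V. x \<noteq> 0 \<longrightarrow> 0 < ip k x x) \<and>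
    (\<forall>k. \<forall>x\<in>V. ip k x x \<le> ip (Suc k) x x) \<and>
    (\<forall>k l X. k \<le> l \<and> (\<forall>j. X j \<in> V) \<and> (\<lambda>j. ip k (X j) (X j)) \<longlonglongrightarrow> 0 \<and>
      (\<forall>\<epsilon>>0. \<exists>N. \<forall>a\<ge>N. \<forall>b\<ge>N. ip l (X a - X b) (X a - X b) < \<epsilon>) \<longrightarrow>
      (\<lambda>j. ip l (X j) (X j)) \<longlonglongrightarrow> 0) \<and>
    (\<forall>k. \<exists>l\<ge>k. \<exists>C. \<forall>S. finite S \<and> S \<subseteq> V \<and>
      (\<forall>s\<in>S. \<forall>t\<in>S. ip l s t = (if s = t then 1 else 0)) \<longrightarrow> (\<Sum>s\<in>S. ip k s s) \<le> C)"

definition complex_scalar_product_on ::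
    "'a::complex_vector set \<Rightarrow> ('a \<Rightarrow> 'a \<Rightarrow> complex) \<Rightarrow> bool"
  where "complex_scalar_product_on V ip \<longleftrightarrow>
    (\<forall>x\<in>V. \<forall>y\<in>V. ip y x = cnj (ip x y)) \<and>
    (\<forall>x\<in>V. clinear_on V (ip x)) \<and>
    (\<forall>x\<in>V. x \<noteq> 0 \<longrightarrow> 0 < Re (ip x x))"

definition sobolev_scales ::
    "('i, 'p, 'v::real_inner, 'w::real_normed_vector, 'f::real_vector, 'x::complex_vector, 'z)
      fields_scheme \<Rightarrow> bool"
  where "sobolev_scales D \<longleftrightarrow>
    (\<forall>k. complex_scalar_product_on UNIV (ipC D k)) \<and>
    countably_hilbert UNIV (\<lambda>k x y. Re (ipC D k x y)) \<and>
    (\<forall>X. (\<forall>k. (\<lambda>j. ipC D k (X j) (X j)) \<longlonglongrightarrow> 0) \<longleftrightarrow> complex_field_null D X) \<and>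
    countably_hilbert (FT D) (ipT D) \<and>
    (\<forall>X. (\<forall>j. X j \<in> FT D) \<longrightarrow>
      ((\<forall>k. (\<lambda>j. ipT D k (X j) (X j)) \<longlonglongrightarrow> 0) \<longleftrightarrow> field_null D X))"


section \<open>Completed tensor powers and the field algebra\<close>

text \<open>\<open>tpow n\<close> is a model of the completed \<open>n\<close>-th tensor power of \<open>'x\<close>, \<open>tensor [x\<^sub>1,\<dots>,x\<^sub>n]\<close> is
  \<open>x\<^sub>1 \<otimes> \<dots> \<otimes> x\<^sub>n\<close>, and \<open>tip m n\<close> is the \<open>m\<close>-th Hilbertian cross scalar product. The
  conditions below determine this up to isomorphism. All \<open>tpow n\<close> live in one type \<open>'t\<close>, so that
  sequences \<open>(G\<^sub>0, G\<^sub>1, \<dots>)\<close> are functions \<open>nat \<Rightarrow> 't\<close>.\<close>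

record ('i, 'p, 'v, 'w, 'f, 'x, 't) tensors = "('i, 'p, 'v, 'w, 'f, 'x) fields" +
  tpow :: "nat \<Rightarrow> 't set"
  tensor :: "'x list \<Rightarrow> 't"
  tip :: "nat \<Rightarrow> nat \<Rightarrow> 't \<Rightarrow> 't \<Rightarrow> complex"
  perm_action :: "nat \<Rightarrow> (nat \<Rightarrow> nat) \<Rightarrow> 't \<Rightarrow> 't"

definition tnorm ::
    "('i, 'p, 'v, 'w, 'f, 'x, 't, 'z) tensors_scheme \<Rightarrow> nat \<Rightarrow> nat \<Rightarrow> 't \<Rightarrow> real"
  where "tnorm D m n t = sqrt (Re (tip D m n t t))"

definition tensor_powers ::
    "('i, 'p, 'v, 'w, 'f, 'x::complex_vector, 't::complex_vector, 'z) tensors_scheme \<Rightarrow> bool"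
  where "tensor_powers D \<longleftrightarrow>
    (\<forall>n. csubspace (tpow D n)) \<and>
    (\<forall>m n. complex_scalar_product_on (tpow D n) (tip D m n)) \<and>
    (\<forall>xs. tensor D xs \<in> tpow D (length xs)) \<and>
    (\<forall>xs ys. clinear_on UNIV (\<lambda>x. tensor D (xs @ x # ys))) \<and>
    (\<forall>m xs ys. length xs = length ys \<longrightarrow>
      tip D m (length xs) (tensor D xs) (tensor D ys) = (\<Prod>a<length xs. ipC D m (xs ! a) (ys ! a))) \<and>
    (\<forall>n. \<forall>t\<in>tpow D n. \<exists>X. (\<forall>k. X k \<in> cspan {tensor D xs | xs. length xs = n}) \<and>
      (\<forall>m. (\<lambda>k. tnorm D m n (X k - t)) \<longlonglongrightarrow> 0)) \<and>
    (\<forall>n X. (\<forall>k. X k \<in> tpow D n) \<and>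
      (\<forall>m. \<forall>\<epsilon>>0. \<exists>N. \<forall>a\<ge>N. \<forall>b\<ge>N. tnorm D m n (X a - X b) < \<epsilon>) \<longrightarrow>
      (\<exists>t\<in>tpow D n. \<forall>m. (\<lambda>k. tnorm D m n (X k - t)) \<longlonglongrightarrow> 0))"

definition tensor_lim ::
    "('i, 'p, 'v, 'w, 'f, 'x, 't::minus, 'z) tensors_scheme \<Rightarrow> nat \<Rightarrow> (nat \<Rightarrow> 't) \<Rightarrow> 't"
  where "tensor_lim D n X =
    (THE t. t \<in> tpow D n \<and> (\<forall>m. (\<lambda>k. tnorm D m n (X k - t)) \<longlonglongrightarrow> 0))"

text \<open>Continuous linear maps \<open>tpow n \<rightarrow> tpow n'\<close>, set to 0 outside of \<open>tpow n\<close>. They are determined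
  by their values on pure tensors, and this is how operators are specified below.\<close>

definition tensor_map ::
    "('i, 'p, 'v, 'w, 'f, 'x, 't::complex_vector, 'z) tensors_scheme \<Rightarrow>
      nat \<Rightarrow> nat \<Rightarrow> ('t \<Rightarrow> 't) \<Rightarrow> bool"
  where "tensor_map D n n' f \<longleftrightarrow>
    (\<forall>t\<in>tpow D n. f t \<in> tpow D n') \<and> clinear_on (tpow D n) f \<and>
    (\<forall>m. \<exists>m' C. \<forall>t\<in>tpow D n. tnorm D m n' (f t) \<le> C * tnorm D m' n t) \<and>
    (\<forall>t. t \<notin> tpow D n \<longrightarrow> f t = 0)"

text \<open>For \<open>x\<^sub>a\<close> in sector \<open>l a\<close>: parity (number of inversions modulo 2) of the permutation \<open>\<pi>\<close>
  among the factors in sector \<open>i\<close>. Positions are counted from 0.\<close>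

definition sector_parity :: "nat \<Rightarrow> (nat \<Rightarrow> nat) \<Rightarrow> (nat \<Rightarrow> nat) \<Rightarrow> nat \<Rightarrow> nat"
  where "sector_parity n \<pi> l i =
    card {(a, b). a < b \<and> b < n \<and> \<pi> b < \<pi> a \<and> l (\<pi> a) = i \<and> l (\<pi> b) = i} mod 2"

text \<open>The action on \<open>n\<close>-fold tensors. It is uniquely determined, since the complexified sectors span \<open>'x\<close>.\<close>

definition permutation_actions ::
    "('i, 'p, 'v, 'w, 'f, 'x::complex_vector, 't::complex_vector, 'z) tensors_scheme \<Rightarrow> bool"
  where "permutation_actions D \<longleftrightarrow>
    (\<forall>n \<pi>. \<pi> permutes {..<n} \<longrightarrow> tensor_map D n n (perm_action D n \<pi>) \<and>
      (\<forall>xs l. length xs = n \<and> (\<forall>a<n. l a < num_sectors D \<and> xs ! a \<in> complex_sector D (l a)) \<longrightarrow>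
        perm_action D n \<pi> (tensor D xs) =
          (- 1) ^ (\<Sum>i<num_sectors D. spin D i * sector_parity n \<pi> l i)
            *\<^sub>C tensor D (map (\<lambda>a. xs ! \<pi> a) [0..<n])))"

definition Psym ::
    "('i, 'p, 'v, 'w, 'f, 'x::complex_vector, 't::complex_vector, 'z) tensors_scheme \<Rightarrow>
      nat \<Rightarrow> 't \<Rightarrow> 't"
  where "Psym D n t = (1 / fact n) *\<^sub>R (\<Sum>\<pi> | \<pi> permutes {..<n}. perm_action D n \<pi> t)"

definition tensor_algebra ::
    "('i, 'p, 'v, 'w, 'f, 'x, 't, 'z) tensors_scheme \<Rightarrow> (nat \<Rightarrow> 't) set"
  where "tensor_algebra D = {G. (\<forall>n. G n \<in> tpow D n) \<and>
    (\<forall>m. summable (\<lambda>n. 2 ^ (m * n) * (tnorm D m n (G n))\<^sup>2))}"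

definition field_algebra ::
    "('i, 'p, 'v, 'w, 'f, 'x::complex_vector, 't::complex_vector, 'z) tensors_scheme \<Rightarrow>
      (nat \<Rightarrow> 't) set"
  where "field_algebra D = {G \<in> tensor_algebra D. \<forall>n. Psym D n (G n) = G n}"

definition alg_inner ::
    "('i, 'p, 'v, 'w, 'f, 'x, 't, 'z) tensors_scheme \<Rightarrow>
      nat \<Rightarrow> (nat \<Rightarrow> 't) \<Rightarrow> (nat \<Rightarrow> 't) \<Rightarrow> complex"
  where "alg_inner D m G G' = (\<Sum>n. 2 ^ (m * n) * tip D m n (G n) (G' n))"

definition alg_norm ::
    "('i, 'p, 'v, 'w, 'f, 'x, 't, 'z) tensors_scheme \<Rightarrow> nat \<Rightarrow> (nat \<Rightarrow> 't) \<Rightarrow> real"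
  where "alg_norm D m G = sqrt (\<Sum>n. 2 ^ (m * n) * (tnorm D m n (G n))\<^sup>2)"

definition in_degree :: "nat \<Rightarrow> 't::zero \<Rightarrow> nat \<Rightarrow> 't"
  where "in_degree k t = (\<lambda>n. if n = k then t else 0)"

definition vacuum :: "('i, 'p, 'v, 'w, 'f, 'x, 't::zero, 'z) tensors_scheme \<Rightarrow> nat \<Rightarrow> 't"
  where "vacuum D = in_degree 0 (tensor D [])"

definition scalar_component ::
    "('i, 'p, 'v, 'w, 'f, 'x, 't::complex_vector, 'z) tensors_scheme \<Rightarrow> (nat \<Rightarrow> 't) \<Rightarrow> complex"
  where "scalar_component D G = (THE c. G 0 = c *\<^sub>C tensor D [])"


section \<open>Insertion and left multiplication\<close>

text \<open>For \<open>p\<close> in the dual of the field algebra, contraction of the degree \<open>k\<close> part of \<open>p\<close> with the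
  first \<open>k\<close> entries. The projection \<^const>\<open>Psym\<close> makes this meaningful on all tensors; it has no
  effect on tensors that are symmetric in the first \<open>k\<close> entries.\<close>

definition contraction ::
    "('i, 'p, 'v, 'w, 'f, 'x::complex_vector, 't::complex_vector, 'z) tensors_scheme \<Rightarrow>
      ((nat \<Rightarrow> 't) \<Rightarrow> complex) \<Rightarrow> nat \<Rightarrow> nat \<Rightarrow> 't \<Rightarrow> 't"
  where "contraction D p k n = (THE f. tensor_map D (k + n) n f \<and>
    (\<forall>xs. length xs = k + n \<longrightarrow>
      f (tensor D xs) =
        p (in_degree k (Psym D k (tensor D (take k xs)))) *\<^sub>C tensor D (drop k xs)))"

definition insertion ::
    "('i, 'p, 'v, 'w, 'f, 'x::complex_vector, 't::complex_vector, 'z) tensors_scheme \<Rightarrow>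
      ((nat \<Rightarrow> 't) \<Rightarrow> complex) \<Rightarrow> (nat \<Rightarrow> 't) \<Rightarrow> nat \<Rightarrow> 't"
  where "insertion D p G = (\<lambda>n. tensor_lim D n (\<lambda>K. \<Sum>k<K. contraction D p k n (G (k + n))))"

definition left_tensor ::
    "('i, 'p, 'v, 'w, 'f, 'x::complex_vector, 't::complex_vector, 'z) tensors_scheme \<Rightarrow>
      'x \<Rightarrow> nat \<Rightarrow> 't \<Rightarrow> 't"
  where "left_tensor D u n = (THE f. tensor_map D n (Suc n) f \<and>
    (\<forall>xs. length xs = n \<longrightarrow> f (tensor D xs) = tensor D (u # xs)))"

definition left_mult ::
    "('i, 'p, 'v, 'w, 'f, 'x::complex_vector, 't::complex_vector, 'z) tensors_scheme \<Rightarrow>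
      'x \<Rightarrow> (nat \<Rightarrow> 't) \<Rightarrow> nat \<Rightarrow> 't"
  where "left_mult D u G = (\<lambda>n. case n of 0 \<Rightarrow> 0
    | Suc k \<Rightarrow> real (Suc k) *\<^sub>R Psym D (Suc k) (left_tensor D u k (G k)))"


section \<open>The regularized master Dyson-Schwinger operator\<close>

text \<open>\<open>el\<close> is the Euler-Lagrange functional. \<open>el_alg\<close> is its representation with respect to the
  reference field \<open>psi0\<close>: an element of the completed tensor product of the strong duals of the
  field algebra and of \<open>FT\<close>, i.e. (both being nuclear Frechet spaces) a jointly continuous
  bilinear form on these spaces. \<open>mollifier\<close> is the smoothing operator \<open>C\<^sub>\<kappa>\<close>.\<close>

record ('i, 'p, 'v, 'w, 'f, 'x, 't) mds_data = "('i, 'p, 'v, 'w, 'f, 'x, 't) tensors" +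
  hbar :: real
  el :: "('i \<Rightarrow> 'p \<Rightarrow> 'w) \<Rightarrow> 'f \<Rightarrow> real"
  psi0 :: "'i \<Rightarrow> 'p \<Rightarrow> 'w"
  el_alg :: "(nat \<Rightarrow> 't) \<Rightarrow> 'f \<Rightarrow> complex"
  mollifier :: "'f \<Rightarrow> 'f"

definition el_functional ::
    "('i, 'p, 'v::real_inner, 'w::real_normed_vector, 'f::real_vector, 'x, 't, 'z)
      mds_data_scheme \<Rightarrow> bool"
  where "el_functional D \<longleftrightarrow>
    (\<forall>\<psi>\<in>affine_sections D. rlinear_on (FT D) (el D \<psi>)) \<and>
    (\<forall>\<Psi> \<psi> X x. (\<forall>k. \<Psi> k \<in> affine_sections D) \<and> \<psi> \<in> affine_sections D \<and>
      (\<forall>k. X k \<in> FT D) \<and> x \<in> FT D \<and>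
      section_null D (\<lambda>k i p. \<Psi> k i p - \<psi> i p) \<and> field_null D (\<lambda>k. X k - x) \<longrightarrow>
      (\<lambda>k. el D (\<Psi> k) (X k)) \<longlonglongrightarrow> el D \<psi> x)"

definition el_dual_element ::
    "('i, 'p, 'v, 'w, 'f::real_vector, 'x::complex_vector, 't::complex_vector, 'z)
      mds_data_scheme \<Rightarrow> bool"
  where "el_dual_element D \<longleftrightarrow>
    (\<forall>\<delta>\<in>FT D.
      (\<forall>G\<in>field_algebra D. \<forall>G'\<in>field_algebra D.
        el_alg D (\<lambda>n. G n + G' n) \<delta> = el_alg D G \<delta> + el_alg D G' \<delta>) \<and>
      (\<forall>c. \<forall>G\<in>field_algebra D. el_alg D (\<lambda>n. c *\<^sub>C G n) \<delta> = c * el_alg D G \<delta>)) \<and>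
    (\<forall>G\<in>field_algebra D. rlinear_on (FT D) (el_alg D G)) \<and>
    (\<exists>m n C. \<forall>G\<in>field_algebra D. \<forall>\<delta>\<in>FT D.
      cmod (el_alg D G \<delta>) \<le> C * alg_norm D m G * sqrt (ipT D n \<delta> \<delta>))"

text \<open>The pairing with \<open>(1, \<phi>, \<phi> \<otimes> \<phi>, \<dots>)\<close>, \<open>\<phi> = \<psi> - psi0\<close>, is taken degree by degree as a
  convergent series, because in general this sequence has infinite norms. In the presence of
  fermionic components the tensor powers are paired through \<^const>\<open>Psym\<close>.\<close>

definition el_represented ::
    "('i, 'p, 'v::real_inner, 'w::real_normed_vector, 'f::real_vector, 'x::complex_vector,
      't::complex_vector, 'z) mds_data_scheme \<Rightarrow> bool"
  where "el_represented D \<longleftrightarrow>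
    (\<forall>\<psi>\<in>affine_sections D. \<forall>\<phi>. \<forall>\<delta>\<in>FT D. (\<forall>i p. rep D \<phi> i p = \<psi> i p - psi0 D i p) \<longrightarrow>
      (\<lambda>k. el_alg D (in_degree k (Psym D k (tensor D (replicate k (emb D \<phi>))))) \<delta>)
        sums complex_of_real (el D \<psi> \<delta>))"

definition mollifying ::
    "('i, 'p::t2_space, 'v::real_inner, 'w::{banach,second_countable_topology}, 'f, 'x, 't, 'z)
      mds_data_scheme \<Rightarrow> bool"
  where "mollifying D \<longleftrightarrow> smoothing_operator D (rep D) (mollifier D) \<and>
    (\<forall>l<num_sectors D. mollifier D ` sector D l \<subseteq> sector D l)"

definition mds_setting ::
    "('i, 'p::t2_space, 'v::real_inner, 'w::{banach,second_countable_topology}, 'f::real_vector,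
      'x::complex_vector, 't::complex_vector, 'z) mds_data_scheme \<Rightarrow> bool"
  where "mds_setting D \<longleftrightarrow>
    compact_oriented_manifold D \<and> affine_bundle D \<and>
    field_space D \<and> real_complex_splitting D \<and> flavor_splitting D \<and>
    partial_complexification D \<and> sobolev_scales D \<and> tensor_powers D \<and> permutation_actions D \<and>
    psi0 D \<in> affine_sections D \<and> el_functional D \<and> el_dual_element D \<and> el_represented D \<and>
    mollifying D"

definition mds_operator ::
    "('i, 'p, 'v, 'w, 'f, 'x::complex_vector, 't::complex_vector, 'z) mds_data_scheme \<Rightarrow>
      (nat \<Rightarrow> 't) \<Rightarrow> 'f \<Rightarrow> nat \<Rightarrow> 't"
  where "mds_operator D G \<delta> = (\<lambda>n.
    insertion D (\<lambda>H. el_alg D H \<delta>) G n -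
    (\<i> * complex_of_real (hbar D)) *\<^sub>C left_mult D (emb D (mollifier D \<delta>)) G n)"


section \<open>The Hilbert space version\<close>

text \<open>\<open>j\<close> is the canonical map of the field algebra into its Hilbert space completion \<open>H\<^sub>m\<close>, which is
  the whole type \<open>'h\<close>.\<close>

definition algebra_completion ::
    "('i, 'p, 'v, 'w, 'f, 'x::complex_vector, 't::complex_vector, 'z) tensors_scheme \<Rightarrow> nat \<Rightarrow>
      ((nat \<Rightarrow> 't) \<Rightarrow> 'h::complex_hilbert) \<Rightarrow> bool"
  where "algebra_completion D m j \<longleftrightarrow>
    (\<forall>G\<in>field_algebra D. \<forall>G'\<in>field_algebra D. j (\<lambda>n. G n + G' n) = j G + j G') \<and>
    (\<forall>c. \<forall>G\<in>field_algebra D. j (\<lambda>n. c *\<^sub>C G n) = c *\<^sub>C j G) \<and>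
    (\<forall>G\<in>field_algebra D. \<forall>G'\<in>field_algebra D. cinner (j G) (j G') = alg_inner D m G G') \<and>
    closure (j ` field_algebra D) = UNIV"

definition test_completion ::
    "('i, 'p, 'v, 'w, 'f::real_vector, 'x, 'z) fields_scheme \<Rightarrow> nat \<Rightarrow>
      ('f \<Rightarrow> 'k::{real_inner,complete_space}) \<Rightarrow> bool"
  where "test_completion D n j \<longleftrightarrow>
    rlinear_on (FT D) j \<and>
    (\<forall>x\<in>FT D. \<forall>y\<in>FT D. inner (j x) (j y) = ipT D n x y) \<and>
    closure (j ` FT D) = UNIV"

text \<open>The continuous extension of the scalar component map to the completion.\<close>

definition scalar_part ::
    "('i, 'p, 'v, 'w, 'f, 'x::complex_vector, 't::complex_vector, 'z) tensors_scheme \<Rightarrow>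
      ((nat \<Rightarrow> 't) \<Rightarrow> 'h::complex_hilbert) \<Rightarrow> 'h \<Rightarrow> complex"
  where "scalar_part D j =
    (THE b. bounded_clinear b \<and> (\<forall>G\<in>field_algebra D. b (j G) = scalar_component D G))"

definition mds_extension ::
    "('i, 'p, 'v, 'w, 'f, 'x::complex_vector, 't::complex_vector, 'z) mds_data_scheme \<Rightarrow>
      ((nat \<Rightarrow> 't) \<Rightarrow> 'hm::complex_hilbert) \<Rightarrow> ('f \<Rightarrow> 'fn::{real_inner,complete_space}) \<Rightarrow>
      ((nat \<Rightarrow> 't) \<Rightarrow> 'h0::complex_hilbert) \<Rightarrow> ('hm \<Rightarrow> 'fn \<Rightarrow> 'hf::complex_hilbert) \<Rightarrow>
      ('hf \<Rightarrow> 'h0) \<Rightarrow> bool"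
  where "mds_extension D jm jF j0 tp M \<longleftrightarrow> hilbert_schmidt M \<and>
    (\<forall>G\<in>field_algebra D. \<forall>\<delta>\<in>FT D. M (tp (jm G) (jF \<delta>)) = j0 (mds_operator D G \<delta>))"

text \<open>\<open>A\<close> is the operator \<open>M\<^sup>2\<close> associated with \<open>M\<close>, where \<open>E\<close> is an orthonormal basis of \<open>F\<^sub>n\<close>.\<close>

definition mds_square ::
    "('hm::complex_hilbert \<Rightarrow> 'fn \<Rightarrow> 'hf) \<Rightarrow> ('hf \<Rightarrow> 'h0::complex_hilbert) \<Rightarrow> 'fn set \<Rightarrow>
      ('hm \<Rightarrow> 'hm) \<Rightarrow> bool"
  where "mds_square tp M E A \<longleftrightarrow> bounded_clinear A \<and>
    (\<forall>G1 G2. ((\<lambda>e. cinner (M (tp G1 e)) (M (tp G2 e))) has_sum cinner G1 (A G2)) E)"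

definition mds_solution ::
    "('i, 'p, 'v, 'w, 'f, 'x::complex_vector, 't::complex_vector, 'z) mds_data_scheme \<Rightarrow>
      ((nat \<Rightarrow> 't) \<Rightarrow> 'hm::complex_hilbert) \<Rightarrow> ('f \<Rightarrow> 'fn) \<Rightarrow> ('hm \<Rightarrow> 'fn \<Rightarrow> 'hf) \<Rightarrow>
      ('hf \<Rightarrow> 'h0::complex_hilbert) \<Rightarrow> 'hm \<Rightarrow> bool"
  where "mds_solution D jm jF tp M G \<longleftrightarrow>
    scalar_part D jm G = 1 \<and> (\<forall>\<delta>\<in>FT D. M (tp G (jF \<delta>)) = 0)"

end

theory Submission
  imports Defs
begin

text \<open>The scalar component is the scalar product with \<open>v = jm (vacuum D)\<close>. Since \<open>M2\<close> is positive
  and bounded by \<open>T\<close>, the operator \<open>1 - M2 / T\<close> is positive and firmly nonexpansive, hence its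
  iterates on \<open>v\<close> converge to a vector \<open>L\<close> in the kernel of \<open>M2\<close>. They do not change scalar products
  with elements of that kernel, so \<open>L\<close> is the projection of \<open>v\<close> to the kernel and
  \<open>\<nu> = \<parallel>L\<parallel>\<^sup>2\<close>. The kernel consists of the vectors which \<open>M\<close> annihilates for all test fields, whence
  it contains a vector with scalar component 1 iff \<open>v\<close> is not orthogonal to it.\<close>

section \<open>Iteration of positive operators\<close>

text \<open>This is the operator inequality A^2 \<le> T A. Positivity of \<open>A\<close> at the
  vector \<open>T *\<^sub>R x - A x\<close>, expanded by symmetry, leaves one term of third order in
  \<open>A\<close>, namely \<open>inner y (A y)\<close> with y = A x. Cauchy-Schwarz and the norm
  bound replace it by T |y|^2.\<close>

lemma positive_symmetric_norm_square_le:
  fixes A :: "'a::real_inner \<Rightarrow> 'a"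
  assumes "bounded_linear A"
    and sym: "\<And>x y. inner x (A y) = inner (A x) y"
    and pos: "\<And>x. 0 \<le> inner x (A x)"
    and "onorm A \<le> T" "T > 0"
  shows "(norm (A x))\<^sup>2 \<le> T * inner x (A x)"
proof -
  interpret A: bounded_linear A by fact
  define y where "y = A x"
  have "inner y (A y) \<le> norm y * norm (A y)"
    by (rule norm_cauchy_schwarz)
  also have "\<dots> \<le> norm y * (T * norm y)"
  proof (rule mult_left_mono)
    have "norm (A y) \<le> onorm A * norm y"
      by (rule onorm) fact
    also have "\<dots> \<le> T * norm y"
      using assms(4) by (rule mult_right_mono) simp
    finally show "norm (A y) \<le> T * norm y" .
  qed simp
  finally have le: "inner y (A y) \<le> T * (norm y)\<^sup>2"
    by (simp add: power2_eq_square mult_ac)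
  have "0 \<le> inner (T *\<^sub>R x - y) (A (T *\<^sub>R x - y))"
    by (rule pos)
  also have "\<dots> = T\<^sup>2 * inner x (A x) - 2 * T * (norm y)\<^sup>2 + inner y (A y)"
  proof -
    have "inner x (A y) = inner y y" "inner y (A x) = inner y y"
      using sym[of x y] by (simp_all add: y_def)
    then show ?thesis
      by (simp add: A.diff A.scaleR inner_diff_left inner_diff_right dot_square_norm
          right_diff_distrib power2_eq_square[of T])
  qed
  also have "\<dots> \<le> T\<^sup>2 * inner x (A x) - T * (norm y)\<^sup>2"
    using le by simp
  also have "\<dots> = T * (T * inner x (A x) - (norm y)\<^sup>2)"
    by (simp add: power2_eq_square algebra_simps)
  finally show ?thesis
    using \<open>T > 0\<close> by (simp add: zero_le_mult_iff y_def)
qed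

text \<open>The numbers \<open>inner (G 0) (G k)\<close> are decreasing and nonnegative, and they control all
  distances by \<open>inner (G j) (G k) = inner (G 0) (G (j + k))\<close>.\<close>

lemma positive_symmetric_iteration:
  fixes A :: "'a::{real_inner,complete_space} \<Rightarrow> 'a"
  assumes bl: "bounded_linear A"
    and sym: "\<And>x y. inner x (A y) = inner (A x) y"
    and pos: "\<And>x. 0 \<le> inner x (A x)"
    and T: "onorm A \<le> T" "T > 0"
    and G: "\<And>k. G (Suc k) = G k - inverse T *\<^sub>R A (G k)"
  shows "convergent G" "A (lim G) = 0"
proof -
  interpret A: bounded_linear A by fact
  define a where "a k = inner (G 0) (G k)" for k
  \<comment> \<open>The step operator 1 - A/T is symmetric, so one iteration can be moved from one
    factor to the other.\<close>
  have G_swap: "inner (G (Suc j)) (G k) = inner (G j) (G (Suc k))" for j k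
    using sym[of "G j" "G k"] by (simp add: G inner_diff)
  have a: "inner (G j) (G k) = a (j + k)" for j k
  proof (induction j arbitrary: k)
    case (Suc j)
    show ?case
      using Suc.IH[of "Suc k"] by (simp add: G_swap)
  qed (simp add: a_def)
  \<comment> \<open>With B = 1 - A/T this says |B x|^2 \<le> <x, B x>. The difference of the two
    sides is (T <x, A x> - |A x|^2) / T^2, which is nonnegative by the preceding lemma.\<close>
  have firm: "inner (G (Suc j)) (G (Suc j)) \<le> inner (G j) (G (Suc j))" for j
  proof -
    have "inner (G j) (G (Suc j)) - inner (G (Suc j)) (G (Suc j))
        = inner (inverse T *\<^sub>R A (G j)) (G (Suc j))"
      by (simp add: G inner_diff_left)
    also have "\<dots> = (T * inner (G j) (A (G j)) - (norm (A (G j)))\<^sup>2) / T\<^sup>2"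
    proof -
      have "inverse T * p - inverse T * (inverse T * q) = (T * p - q) / T\<^sup>2" for p q
        using T(2) by (simp add: field_simps power2_eq_square)
      then show ?thesis
        unfolding G inner_diff_right inner_scaleR_left inner_scaleR_right
          inner_commute[of "A (G j)" "G j"] power2_norm_eq_inner .
    qed
    also have "\<dots> \<ge> 0"
      using positive_symmetric_norm_square_le[OF bl sym pos T] by simp
    finally show ?thesis by simp
  qed
  have le: "inner (G j) (G (Suc j)) \<le> inner (G j) (G j)" for j
    using pos[of "G j"] T(2) by (simp add: G inner_diff)
  \<comment> \<open>An even index splits as j + j and uses positivity of \<open>A\<close>; an odd
    one splits as Suc j + j and uses \<open>firm\<close>.\<close>
  have dec: "a (Suc k) \<le> a k" for k
  proof (cases "even k")
    case True
    then obtain j where "k = j + j" by (auto elim!: evenE simp: mult_2)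
    then show ?thesis using le[of j] by (simp add: a)
  next
    case False
    then obtain j where "k = Suc (j + j)" by (auto elim!: oddE simp: mult_2)
    then show ?thesis using firm[of j] by (simp add: a)
  qed
  \<comment> \<open>Only even indices give squares, a (k + k) = |G k|^2. Monotonicity carries the
    lower bound back to \<open>a k\<close>.\<close>
  have nonneg: "0 \<le> a k" for k
  proof -
    have "0 \<le> a (k + k)"
      using a[of k k] by (metis inner_ge_zero)
    also have "\<dots> \<le> a k"
      by (rule lift_Suc_antimono_le[of a, OF dec]) simp
    finally show ?thesis .
  qed
  have "convergent a"
  proof (rule Bseq_monoseq_convergent)
    show "monoseq a"
      using dec by (simp add: monoseq_Suc)
    show "Bseq a"
    proof (rule BseqI')
      show "norm (a k) \<le> a 0" for k
        using nonneg[of k] lift_Suc_antimono_le[of a 0 k, OF dec] by simp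
    qed
  qed
  then have "Cauchy a" by (rule convergent_Cauchy)
  have "Cauchy G"
  proof (rule metric_CauchyI)
    fix e :: real assume "e > 0"
    then have "e\<^sup>2 / 2 > 0" by simp
    with \<open>Cauchy a\<close> obtain N where N: "\<And>i j. i \<ge> N \<Longrightarrow> j \<ge> N \<Longrightarrow> dist (a i) (a j) < e\<^sup>2 / 2"
      unfolding Cauchy_def by meson
    have "dist (G i) (G j) < e" if "i \<ge> N" "j \<ge> N" for i j
    proof -
      \<comment> \<open>The squared distance is a second difference of \<open>a\<close>, so the
        Cauchy property of the real sequence passes to \<open>G\<close>.\<close>
      have "(dist (G i) (G j))\<^sup>2 = (a (i + i) - a (i + j)) + (a (j + j) - a (i + j))"
        by (simp add: dist_norm power2_norm_eq_inner inner_diff a add.commute)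
      also have "\<dots> < e\<^sup>2"
        using N[OF trans_le_add1[OF that(1), of i] trans_le_add1[OF that(1), of j]]
          N[OF trans_le_add1[OF that(2), of j] trans_le_add1[OF that(1), of j]]
        unfolding dist_real_def by linarith
      finally show ?thesis
        using \<open>e > 0\<close> by (auto intro: power_less_imp_less_base)
    qed
    then show "\<exists>M. \<forall>i\<ge>M. \<forall>j\<ge>M. dist (G i) (G j) < e" by blast
  qed
  then show "convergent G" by (rule Cauchy_convergent)
  then have lim: "G \<longlonglongrightarrow> lim G" by (simp add: convergent_LIMSEQ_iff)
  \<comment> \<open>Passing to the limit in the recursion shows that the limit is a fixed point of 1
    - A/T, that is, a zero of \<open>A\<close>.\<close>
  have "(\<lambda>k. G (Suc k)) \<longlonglongrightarrow> lim G - inverse T *\<^sub>R A (lim G)"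
    unfolding G by (intro tendsto_intros A.tendsto lim)
  moreover have "(\<lambda>k. G (Suc k)) \<longlonglongrightarrow> lim G"
    using lim by (rule LIMSEQ_Suc)
  ultimately have "lim G - inverse T *\<^sub>R A (lim G) = lim G"
    by (rule LIMSEQ_unique)
  then show "A (lim G) = 0" using T(2) by simp
qed

section \<open>Complex scalar products\<close>

lemma cinner_self: "cinner x x = complex_of_real ((norm x)\<^sup>2)"
proof -
  have "Im (cinner x x) = 0"
    using arg_cong[where f = Im, OF cinner_commute[of x x]] by simp
  then show ?thesis
    by (simp add: complex_eq_iff Re_cinner power2_norm_eq_inner)
qed

text \<open>Antilinearity in the first argument recovers the imaginary part from the real inner
  product. Continuity of \<open>cinner\<close> thereby reduces to that of
  \<open>inner\<close>.\<close>

lemma cinner_eq: "cinner x y = complex_of_real (inner x y) + \<i> * complex_of_real (inner (\<i> *\<^sub>C x) y)"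
proof -
  have "inner (\<i> *\<^sub>C x) y = Re (cinner y (\<i> *\<^sub>C x))"
    by (simp add: Re_cinner inner_commute)
  also have "\<dots> = Im (cinner x y)"
    using cinner_commute[of y x] by (simp add: cinner_scaleC_right)
  finally show ?thesis
    by (simp add: complex_eq_iff Re_cinner)
qed

lemma bounded_clinear_cinner: "bounded_clinear (cinner x)"
proof -
  have "bounded_linear (cinner x)"
    unfolding cinner_eq[abs_def]
    by (intro bounded_linear_add bounded_linear_const_mult
        bounded_linear_compose[OF bounded_linear_of_real] bounded_linear_inner_right)
  then show ?thesis
    by (simp add: bounded_clinear_def clinear_on_def cinner_add_right cinner_scaleC_right
        scaleC_complex_def)
qed

lemma scaleC_zero_left [simp]: "0 *\<^sub>C (x::'a::complex_vector) = 0"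
  using scaleC_of_real[of 0 x] by simp

lemma scaleC_one [simp]: "1 *\<^sub>C (x::'a::complex_vector) = x"
  using scaleC_of_real[of 1 x] by simp

lemma scaleC_minus_one: "(- 1) *\<^sub>C (x::'a::complex_vector) = - x"
  using scaleC_of_real[of "- 1" x] by simp

lemma cinner_zero_right [simp]: "cinner x 0 = 0"
  using cinner_scaleC_right[of x 0 0] by simp

lemma cinner_zero_left [simp]: "cinner 0 x = 0"
  using cinner_commute[of 0 x] by simp

lemma csubspace_diff:
  assumes "csubspace V" "x \<in> V" "y \<in> V"
  shows "x - y \<in> V"
proof -
  have "x + (- 1) *\<^sub>C y \<in> V"
    using assms unfolding csubspace_def by blast
  then show ?thesis by (simp add: scaleC_minus_one)
qed

lemma clinear_on_zero:
  assumes "clinear_on V f" "0 \<in> V"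
  shows "f 0 = 0"
proof -
  have "f (0 *\<^sub>C 0) = 0 *\<^sub>C f 0"
    using assms unfolding clinear_on_def by blast
  then show ?thesis by simp
qed

lemma clinear_on_diff:
  assumes "clinear_on V f" "csubspace V" "x \<in> V" "y \<in> V"
  shows "f (x - y) = f x - f y"
proof -
  have "(- 1) *\<^sub>C y \<in> V"
    using assms(2,4) unfolding csubspace_def by blast
  then have "f (x + (- 1) *\<^sub>C y) = f x + (- 1) *\<^sub>C f y"
    using assms(1,3,4) unfolding clinear_on_def by simp
  then show ?thesis by (simp add: scaleC_minus_one)
qed

text \<open>Makes the general facts about \<open>module.span\<close>, through which
  \<open>cspan\<close> is defined, available for complex scalars.\<close>

lemma module_scaleC: "module (scaleC :: complex \<Rightarrow> 'a \<Rightarrow> 'a::complex_vector)"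
  by unfold_locales
    (simp_all add: scaleC_add_left scaleC_add_right scaleC_scaleC)

lemma cspan_singleton: "cspan {x} = range (\<lambda>c. c *\<^sub>C x)"
  using module.span_singleton[OF module_scaleC, of x] .

section \<open>The scalar component\<close>

context
  fixes D :: "('i, 'p, 'v, 'w, 'f, 'x::complex_vector, 't::complex_vector, 'z) tensors_scheme"
  assumes D: "tensor_powers D"
begin

lemma csubspace_tpow: "csubspace (tpow D n)"
  using D[unfolded tensor_powers_def, THEN conjunct1] by (rule spec)

lemma zero_in_tpow: "0 \<in> tpow D n"
  using csubspace_tpow[of n] by (simp add: csubspace_def)

lemma scalar_product_tpow: "complex_scalar_product_on (tpow D n) (tip D m n)"
  using D[unfolded tensor_powers_def, THEN conjunct2, THEN conjunct1] by (elim allE)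

lemma tensor_in_tpow: "tensor D xs \<in> tpow D (length xs)"
  using D[unfolded tensor_powers_def, THEN conjunct2, THEN conjunct2, THEN conjunct1]
  by (elim allE)

lemma tip_tensor:
  "length xs = length ys \<Longrightarrow>
    tip D m (length xs) (tensor D xs) (tensor D ys) = (\<Prod>a<length xs. ipC D m (xs ! a) (ys ! a))"
  using D[unfolded tensor_powers_def, THEN conjunct2, THEN conjunct2, THEN conjunct2,
      THEN conjunct2, THEN conjunct1, rule_format] .

lemma tensor_dense:
  "t \<in> tpow D n \<Longrightarrow> \<exists>X. (\<forall>k. X k \<in> cspan {tensor D xs | xs. length xs = n}) \<and>
    (\<forall>m. (\<lambda>k. tnorm D m n (X k - t)) \<longlonglongrightarrow> 0)"
  using D[unfolded tensor_powers_def, THEN conjunct2, THEN conjunct2, THEN conjunct2,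
      THEN conjunct2, THEN conjunct2, THEN conjunct1, THEN spec, THEN bspec] .

lemma tip_commute:
  "s \<in> tpow D n \<Longrightarrow> t \<in> tpow D n \<Longrightarrow> tip D m n t s = cnj (tip D m n s t)"
  using scalar_product_tpow[unfolded complex_scalar_product_on_def, THEN conjunct1,
      THEN bspec, THEN bspec] .

lemma clinear_on_tip: "s \<in> tpow D n \<Longrightarrow> clinear_on (tpow D n) (tip D m n s)"
  using scalar_product_tpow[unfolded complex_scalar_product_on_def, THEN conjunct2,
      THEN conjunct1, THEN bspec] .

lemma tip_self_pos: "t \<in> tpow D n \<Longrightarrow> t \<noteq> 0 \<Longrightarrow> 0 < Re (tip D m n t t)"
  using scalar_product_tpow[unfolded complex_scalar_product_on_def, THEN conjunct2,
      THEN conjunct2, THEN bspec, THEN mp] .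

lemma tip_scaleC:
  "s \<in> tpow D n \<Longrightarrow> t \<in> tpow D n \<Longrightarrow> tip D m n s (c *\<^sub>C t) = c * tip D m n s t"
  using clinear_on_tip[of s n m] by (simp add: clinear_on_def scaleC_complex_def)

lemma tip_zero:
  assumes "t \<in> tpow D n"
  shows "tip D m n t 0 = 0" "tip D m n 0 t = 0"
  using clinear_on_zero[OF clinear_on_tip[OF assms] zero_in_tpow]
    tip_commute[OF assms zero_in_tpow] by simp_all

lemma tensor_Nil_in_tpow: "tensor D [] \<in> tpow D 0"
  using tensor_in_tpow[of "[]"] by simp

lemma tip_tensor_Nil: "tip D m 0 (tensor D []) (tensor D []) = 1"
  using tip_tensor[of "[]" "[]" m] by simp

text \<open>The degree 0 space is specified only as a completion of the span of
  \<open>tensor D []\<close>, so its being a complex line has to be derived. The part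
  \<open>w\<close> of \<open>t\<close> orthogonal to that line is a lower bound for the distance of
  \<open>t\<close> to every approximant, hence vanishes.\<close>

lemma tensor_Nil_scalar:
  assumes "t \<in> tpow D 0"
  shows "t = tip D m 0 (tensor D []) t *\<^sub>C tensor D []"
proof -
  define u where "u = tensor D []"
  define c where "c = tip D m 0 u t"
  define w where "w = t - c *\<^sub>C u"
  have u: "u \<in> tpow D 0" and uu: "tip D m 0 u u = 1"
    using tensor_Nil_in_tpow tip_tensor_Nil by (simp_all add: u_def)
  note sub = csubspace_tpow[of 0] and lin = clinear_on_tip[of _ 0 m]
    and herm = tip_commute[of _ 0 _ m] and scale = tip_scaleC[of _ 0 _ m]
  have cu: "d *\<^sub>C u \<in> tpow D 0" for d
    using sub u by (simp add: csubspace_def)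
  have w: "w \<in> tpow D 0"
    using csubspace_diff[OF sub assms cu] by (simp add: w_def)
  have uw: "tip D m 0 u w = 0"
    using clinear_on_diff[OF lin[OF u] sub assms cu] scale[OF u u] uu
    by (simp add: w_def c_def)
  obtain X where X_span: "\<forall>k. X k \<in> cspan {tensor D xs | xs. length xs = 0}"
    and X_lim: "\<forall>m. (\<lambda>k. tnorm D m 0 (X k - t)) \<longlonglongrightarrow> 0"
    using tensor_dense[OF assms] by (elim exE conjE)
  have ge: "sqrt (Re (tip D m 0 w w)) \<le> tnorm D m 0 (X k - t)" for k
  proof -
    have "{tensor D xs | xs. length xs = 0} = {u}"
      by (simp add: u_def)
    then have "X k \<in> range (\<lambda>d. d *\<^sub>C u)"
      using X_span[rule_format, of k] by (simp only: cspan_singleton)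
    then obtain d where "X k = d *\<^sub>C u" ..
    moreover have "d *\<^sub>C u = (d - c) *\<^sub>C u + c *\<^sub>C u"
      using scaleC_add_left[of "d - c" c u] by simp
    ultimately have *: "X k - t = (d - c) *\<^sub>C u - w"
      by (simp add: w_def)
    \<comment> \<open>Now X k - t = z - w with \<open>z\<close> on the line and \<open>w\<close>
      orthogonal to it; the following lines are Pythagoras for this difference.\<close>
    define z where "z = (d - c) *\<^sub>C u"
    have z: "z \<in> tpow D 0" using cu by (simp add: z_def)
    have zw: "z - w \<in> tpow D 0" using csubspace_diff[OF sub z w] .
    have "tip D m 0 w z = 0"
      using scale[OF w u] herm[OF u w] uw by (simp add: z_def)
    moreover have "tip D m 0 z w = 0"
      using herm[OF w z] calculation by simp
    moreover have "tip D m 0 z z = (d - c) * cnj (d - c)"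
      using scale[OF z u] scale[OF u u] herm[OF u z] uu by (simp add: z_def)
    moreover have "tip D m 0 (z - w) (z - w) = tip D m 0 (z - w) z - tip D m 0 (z - w) w"
      using clinear_on_diff[OF lin[OF zw] sub z w] .
    moreover have "tip D m 0 (z - w) z = cnj (tip D m 0 z z - tip D m 0 z w)"
      using herm[OF z zw] clinear_on_diff[OF lin[OF z] sub z w] by simp
    moreover have "tip D m 0 (z - w) w = cnj (tip D m 0 w z - tip D m 0 w w)"
      using herm[OF w zw] clinear_on_diff[OF lin[OF w] sub z w] by simp
    ultimately have "tip D m 0 (z - w) (z - w) = cnj ((d - c) * cnj (d - c)) + cnj (tip D m 0 w w)"
      by simp
    then have "Re (tip D m 0 (z - w) (z - w)) = (cmod (d - c))\<^sup>2 + Re (tip D m 0 w w)"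
      by (simp only: complex_norm_square[symmetric] plus_complex.sel cnj.sel Re_complex_of_real)
    then show ?thesis
      by (simp add: tnorm_def * z_def)
  qed
  have "sqrt (Re (tip D m 0 w w)) \<le> 0"
    using X_lim[rule_format, of m] by (rule LIMSEQ_le_const) (use ge in blast)
  then have "\<not> 0 < Re (tip D m 0 w w)" by simp
  then have "w = 0"
    using tip_self_pos[OF w] by blast
  then show ?thesis
    unfolding w_def c_def u_def right_minus_eq .
qed

lemma scalar_component_eq_tip:
  assumes "G 0 \<in> tpow D 0"
  shows "scalar_component D G = tip D m 0 (tensor D []) (G 0)"
  unfolding scalar_component_def
proof (rule the_equality)
  show "G 0 = tip D m 0 (tensor D []) (G 0) *\<^sub>C tensor D []"
    using tensor_Nil_scalar[OF assms] .
next
  fix c assume "G 0 = c *\<^sub>C tensor D []"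
  then show "c = tip D m 0 (tensor D []) (G 0)"
    by (simp add: tip_scaleC tensor_Nil_in_tpow tip_tensor_Nil)
qed

text \<open>Only degree 0 contributes, where the weight 2^(m n) is 1; therefore the result is the
  same for every \<open>m\<close>.\<close>

lemma alg_inner_vacuum:
  assumes "G \<in> field_algebra D"
  shows "alg_inner D m (vacuum D) G = scalar_component D G"
proof -
  have G: "G n \<in> tpow D n" for n
    using assms by (simp add: field_algebra_def tensor_algebra_def)
  have "alg_inner D m (vacuum D) G
      = (\<Sum>n. if n = 0 then tip D m 0 (tensor D []) (G 0) else 0)"
    unfolding alg_inner_def
    by (rule suminf_cong) (simp add: vacuum_def in_degree_def tip_zero(2)[OF G])
  also have "\<dots> = tip D m 0 (tensor D []) (G 0)"
    using suminf_finite[of "{0::nat}" "\<lambda>n. if n = 0 then tip D m 0 (tensor D []) (G 0) else 0"]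
    by simp
  also have "\<dots> = scalar_component D G"
    using scalar_component_eq_tip[where m = m and G = G, OF G] by simp
  finally show ?thesis .
qed

section \<open>The vacuum as an element of the field algebra, and the extended scalar
  component\<close>

lemma Psym_zero:
  assumes "permutation_actions D"
  shows "Psym D n 0 = 0"
proof -
  have "perm_action D n \<pi> 0 = 0" if "\<pi> permutes {..<n}" for \<pi>
  proof (rule clinear_on_zero[OF _ zero_in_tpow])
    have "tensor_map D n n (perm_action D n \<pi>)"
      using assms that unfolding permutation_actions_def by blast
    then show "clinear_on (tpow D n) (perm_action D n \<pi>)"
      unfolding tensor_map_def by blast
  qed
  then show ?thesis
    by (simp add: Psym_def)
qed

lemma Psym_tensor_Nil:
  assumes "permutation_actions D"
  shows "Psym D 0 (tensor D []) = tensor D []"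
proof -
  have "id permutes {..<0::nat}"
    by (rule permutes_id)
  then have "\<forall>xs l. length xs = 0 \<and> (\<forall>a<0. l a < num_sectors D \<and> xs ! a \<in> complex_sector D (l a)) \<longrightarrow>
        perm_action D 0 id (tensor D xs) =
          (- 1) ^ (\<Sum>i<num_sectors D. spin D i * sector_parity 0 id l i)
            *\<^sub>C tensor D (map (\<lambda>a. xs ! id a) [0..<0])"
    using assms unfolding permutation_actions_def by blast
  \<comment> \<open>There are no positions to label, so any labelling will do; without inversions
    the sign is 1.\<close>
  from this[rule_format, of "[]" "\<lambda>_. 0"]
  have "perm_action D 0 id (tensor D []) = tensor D []"
    by (simp add: sector_parity_def)
  moreover have "{\<pi>. \<pi> permutes {..<0::nat}} = {id}"
    by auto
  ultimately show ?thesis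
    by (simp add: Psym_def)
qed

lemma vacuum_in_field_algebra:
  assumes "permutation_actions D"
  shows "vacuum D \<in> field_algebra D"
proof -
  have "summable (\<lambda>n. 2 ^ (m * n) * (tnorm D m n (vacuum D n))\<^sup>2)" for m
    by (rule summable_finite[of "{0}"])
      (simp_all add: vacuum_def in_degree_def tnorm_def tip_zero zero_in_tpow)
  moreover have "vacuum D n \<in> tpow D n" for n
    by (simp add: vacuum_def in_degree_def tensor_Nil_in_tpow zero_in_tpow)
  moreover have "Psym D n (vacuum D n) = vacuum D n" for n
    by (simp add: vacuum_def in_degree_def Psym_zero[OF assms] Psym_tensor_Nil[OF assms])
  ultimately show ?thesis
    by (simp add: field_algebra_def tensor_algebra_def)
qed

text \<open>The scalar product with the vacuum is a bounded extension of the scalar component. Two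
  bounded extensions agree on a closed set containing the dense image of the field algebra, which
  settles the definite description.\<close>

lemma scalar_part_eq_cinner:
  assumes "permutation_actions D" "algebra_completion D m j"
  shows "scalar_part D j = cinner (j (vacuum D))"
  unfolding scalar_part_def
proof (rule the_equality)
  have inner_j: "cinner (j G) (j G') = alg_inner D m G G'"
    if "G \<in> field_algebra D" "G' \<in> field_algebra D" for G G'
    using assms(2) that unfolding algebra_completion_def by blast
  have dense: "closure (j ` field_algebra D) = UNIV"
    using assms(2) unfolding algebra_completion_def by blast
  show *: "bounded_clinear (cinner (j (vacuum D))) \<and>
      (\<forall>G\<in>field_algebra D. cinner (j (vacuum D)) (j G) = scalar_component D G)"
    by (simp add: inner_j vacuum_in_field_algebra[OF assms(1)] alg_inner_vacuum
        bounded_clinear_cinner)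
  fix b assume b: "bounded_clinear b \<and> (\<forall>G\<in>field_algebra D. b (j G) = scalar_component D G)"
  define S where "S = {x. b x = cinner (j (vacuum D)) x}"
  have "closed S"
    unfolding S_def using b bounded_clinear_cinner[of "j (vacuum D)"]
    by (intro closed_Collect_eq linear_continuous_on) (simp_all add: bounded_clinear_def)
  moreover have "j ` field_algebra D \<subseteq> S"
    using b * by (auto simp: S_def)
  ultimately have "closure (j ` field_algebra D) \<subseteq> S"
    by (simp add: closure_minimal)
  then have "S = UNIV"
    using dense by blast
  then show "b = cinner (j (vacuum D))"
    by (auto simp: S_def)
qed

end

section \<open>The kernel of the squared operator\<close>

lemma bounded_linear_tensor_right:
  assumes "hilbert_tensor_product tp"
  shows "bounded_linear (tp G)"
proof -
  have "linear (tp G)"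
    using assms by (simp add: hilbert_tensor_product_def)
  moreover have "norm (tp G x) = norm x * norm G" for x
  proof -
    have "cinner (tp G x) (tp G x) = cinner G G * complex_of_real (inner x x)"
      using assms by (simp add: hilbert_tensor_product_def)
    then have "complex_of_real ((norm (tp G x))\<^sup>2) = complex_of_real ((norm G)\<^sup>2 * inner x x)"
      by (simp add: cinner_self)
    then have "(norm (tp G x))\<^sup>2 = (norm x * norm G)\<^sup>2"
      by (simp only: of_real_eq_iff power2_norm_eq_inner[of x, symmetric] power_mult_distrib
          mult.commute)
    then show ?thesis by simp
  qed
  ultimately show ?thesis
    by (intro bounded_linear_intro[of _ "norm G"]) (simp_all add: linear_add linear_scale)
qed

text \<open>Conjugating the series for \<open>cinner y (A x)\<close> termwise gives the series for
  \<open>cinner x (A y)\<close>, and sums are unique.\<close>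

lemma mds_square_symmetric:
  assumes "mds_square tp M E A"
  shows "cinner x (A y) = cinner (A x) y"
proof -
  have *: "((\<lambda>e. cinner (M (tp x e)) (M (tp y e))) has_sum cinner x (A y)) E" for x y
    using assms by (simp add: mds_square_def)
  have "((\<lambda>e. cnj (cinner (M (tp y e)) (M (tp x e)))) has_sum cnj (cinner y (A x))) E"
    using *[of y x] by (simp only: has_sum_cnj_iff)
  then have "((\<lambda>e. cinner (M (tp x e)) (M (tp y e))) has_sum cinner (A x) y) E"
    by (simp only: cinner_commute[symmetric])
  with * show ?thesis
    by (rule has_sum_unique)
qed

lemma mds_square_has_sum:
  assumes "mds_square tp M E A"
  shows "((\<lambda>e. (norm (M (tp x e)))\<^sup>2) has_sum inner x (A x)) E"
proof -
  have "((\<lambda>e. cinner (M (tp x e)) (M (tp x e))) has_sum cinner x (A x)) E"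
    using assms by (simp add: mds_square_def)
  from has_sum_Re[OF this] show ?thesis
    by (simp add: cinner_self Re_cinner flip: of_real_power)
qed

text \<open>If A x = 0, the nonnegative terms |M (x \<otimes> e)|^2 sum to <x, A x> = 0, so M (x
  \<otimes> \<cdot>) vanishes on the basis and, being linear and continuous, everywhere.\<close>

lemma mds_square_eq_0_iff:
  assumes tp: "hilbert_tensor_product tp" and M: "bounded_linear M"
    and E: "real_hilbert_basis E" and A: "mds_square tp M E A"
  shows "A x = 0 \<longleftrightarrow> (\<forall>y. M (tp x y) = 0)"
proof
  assume "A x = 0"
  then have "((\<lambda>e. (norm (M (tp x e)))\<^sup>2) has_sum 0) E"
    using mds_square_has_sum[OF A, of x] by simp
  then have ann: "M (tp x e) = 0" if "e \<in> E" for e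
    using nonneg_has_sum_le_0D[OF _ order_refl _ that] by fastforce
  have bl: "bounded_linear (\<lambda>y. M (tp x y))"
    using bounded_linear_compose[OF M bounded_linear_tensor_right[OF tp]] .
  have "closed {y. M (tp x y) = 0}"
    by (intro closed_Collect_eq linear_continuous_on bl continuous_on_const)
  moreover have "span E \<subseteq> {y. M (tp x y) = 0}"
    using linear_eq_0_on_span[OF bounded_linear.linear[OF bl], of E] ann by blast
  ultimately have "closure (span E) \<subseteq> {y. M (tp x y) = 0}"
    by (simp add: closure_minimal)
  then show "\<forall>y. M (tp x y) = 0"
    using E by (auto simp: real_hilbert_basis_def)
next
  assume "\<forall>y. M (tp x y) = 0"
  \<comment> \<open>Taking \<open>A x\<close> as first argument of the form turns its value into |A
    x|^2, while every term contains the factor M (x \<otimes> e) = 0.\<close>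
  moreover have "((\<lambda>e. cinner (M (tp (A x) e)) (M (tp x e))) has_sum cinner (A x) (A x)) E"
    using A by (simp add: mds_square_def)
  ultimately have "((\<lambda>e. 0) has_sum cinner (A x) (A x)) E"
    by simp
  then have "cinner (A x) (A x) = 0"
    using has_sum_0_simp has_sum_unique by blast
  then show "A x = 0"
    by (simp add: cinner_self)
qed

text \<open>The test fields are dense in their completion and M (x \<otimes> \<cdot>) is continuous.
  This passes from the equation for smooth test fields to the kernel condition.\<close>

lemma test_completion_annihilates_iff:
  assumes tp: "hilbert_tensor_product tp" and M: "bounded_linear M"
    and j: "test_completion D n j"
  shows "(\<forall>\<delta>\<in>FT D. M (tp x (j \<delta>)) = 0) \<longleftrightarrow> (\<forall>y. M (tp x y) = 0)"
proof
  assume *: "\<forall>\<delta>\<in>FT D. M (tp x (j \<delta>)) = 0"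
  have "closed {y. M (tp x y) = 0}"
    by (intro closed_Collect_eq linear_continuous_on continuous_on_const
        bounded_linear_compose[OF M bounded_linear_tensor_right[OF tp]])
  moreover have "j ` FT D \<subseteq> {y. M (tp x y) = 0}"
    using * by blast
  ultimately have "closure (j ` FT D) \<subseteq> {y. M (tp x y) = 0}"
    by (simp add: closure_minimal)
  then show "\<forall>y. M (tp x y) = 0"
    using j by (auto simp: test_completion_def)
qed simp

section \<open>Convergence of the iteration and the solvability criterion\<close>

theorem corollary35:
  fixes D :: "('i, 'p::t2_space, 'v::real_inner, 'w::{banach,second_countable_topology},
      'f::real_vector, 'x::complex_vector, 't::complex_vector) mds_data"
    and m n :: nat
    and jm :: "(nat \<Rightarrow> 't) \<Rightarrow> 'hm::complex_hilbert"
    and j0 :: "(nat \<Rightarrow> 't) \<Rightarrow> 'h0::complex_hilbert"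
    and jF :: "'f \<Rightarrow> 'fn::{real_inner,complete_space}"
    and tp :: "'hm \<Rightarrow> 'fn \<Rightarrow> 'hf::complex_hilbert"
    and M :: "'hf \<Rightarrow> 'h0"
    and E :: "'fn set"
    and M2 :: "'hm \<Rightarrow> 'hm"
    and T :: real
    and G :: "nat \<Rightarrow> 'hm"
  assumes "mds_setting D"
    and "algebra_completion D m jm"
    and "algebra_completion D 0 j0"
    and "test_completion D n jF"
    and "hilbert_tensor_product tp"
    and "mds_extension D jm jF j0 tp M"
    and "real_hilbert_basis E"
    and "mds_square tp M E M2"
    and "T > 0" and "onorm M2 \<le> T"
    and "G 0 = jm (vacuum D)"
    and "\<And>k. G (Suc k) = G k - inverse T *\<^sub>R M2 (G k)"
  shows "convergent G \<and>
    (\<exists>\<nu>::real. (\<lambda>k. scalar_part D jm (G k)) \<longlonglongrightarrow> complex_of_real \<nu> \<and>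
      ((\<exists>H. mds_solution D jm jF tp M H) \<longleftrightarrow> \<nu> \<noteq> 0) \<and>
      (\<nu> \<noteq> 0 \<longrightarrow> mds_solution D jm jF tp M ((1 / \<nu>) *\<^sub>R lim G)))"
proof -
  define v where "v = jm (vacuum D)"
  define L where "L = lim G"
  have tens: "tensor_powers D" "permutation_actions D"
    using assms(1) by (simp_all add: mds_setting_def)
  have sp: "scalar_part D jm = cinner v"
    using scalar_part_eq_cinner[OF tens assms(2)] by (simp add: v_def)
  have M: "bounded_linear M"
    using assms(6) by (simp add: mds_extension_def hilbert_schmidt_def bounded_clinear_def)
  have M2: "bounded_linear M2"
    using assms(8) by (simp add: mds_square_def bounded_clinear_def)
  note sym = mds_square_symmetric[OF assms(8)]
  \<comment> \<open>From here on the equation is a question about the kernel of \<open>M2\<close>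
    and the vector \<open>v\<close>.\<close>
  have solution_iff: "mds_solution D jm jF tp M H \<longleftrightarrow> cinner v H = 1 \<and> M2 H = 0" for H
    unfolding mds_solution_def sp test_completion_annihilates_iff[OF assms(5) M assms(4)]
      mds_square_eq_0_iff[OF assms(5) M assms(7,8)] ..
  have re_sym: "inner x (M2 y) = inner (M2 x) y" for x y
    using sym[of x y] by (simp flip: Re_cinner)
  have pos: "0 \<le> inner x (M2 x)" for x
    using mds_square_has_sum[OF assms(8)] by (rule has_sum_nonneg) simp
  note iter = positive_symmetric_iteration[where G = G, OF M2 re_sym pos assms(10,9,12)]
  have lim: "G \<longlonglongrightarrow> L"
    using iter(1) by (simp add: L_def convergent_LIMSEQ_iff)
  have tends: "(\<lambda>k. cinner H (G k)) \<longlonglongrightarrow> cinner H L" for H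
    using bounded_clinear_cinner[of H] lim
    by (auto simp: bounded_clinear_def intro: bounded_linear.tendsto)
  \<comment> \<open>The correction terms lie in the range of the symmetric operator
    \<open>M2\<close>, hence are orthogonal to its kernel. Thus \<open>L\<close> is the orthogonal
    projection of \<open>v\<close> to the kernel.\<close>
  have const: "cinner H L = cinner H v" if "M2 H = 0" for H
  proof -
    have "cinner H (inverse T *\<^sub>R M2 (G k)) = 0" for k
      using sym[of H "G k"] that
      by (simp add: cinner_scaleC_right flip: scaleC_of_real)
    then have "cinner H (G (Suc k)) = cinner H (G k)" for k
      using cinner_add_right[of H "G (Suc k)" "inverse T *\<^sub>R M2 (G k)"]
      by (simp add: assms(12))
    then have "cinner H (G k) = cinner H v" for k
      by (induction k) (simp_all add: assms(11) v_def)
    then show ?thesis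
      using tends[of H] by (simp add: LIMSEQ_const_iff)
  qed
  define \<nu> where "\<nu> = (norm L)\<^sup>2"
  have kerL: "M2 L = 0"
    using iter(2) by (simp add: L_def)
  \<comment> \<open>Apply \<open>const\<close> to H = L, which lies in the kernel itself: <L, v> =
    <L, L> is real, so conjugation does not change it.\<close>
  have vL: "cinner v L = complex_of_real \<nu>"
    using cinner_commute[of v L] unfolding const[OF kerL, symmetric] cinner_self \<nu>_def by simp
  have "(\<lambda>k. scalar_part D jm (G k)) \<longlonglongrightarrow> complex_of_real \<nu>"
    using tends[of v] by (simp add: sp vL)
  moreover have sol: "mds_solution D jm jF tp M ((1 / \<nu>) *\<^sub>R L)" if "\<nu> \<noteq> 0"
  proof -
    have "cinner v ((1 / \<nu>) *\<^sub>R L) = 1"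
      using that vL cinner_scaleC_right[of v "complex_of_real (1 / \<nu>)" L]
      by (simp only: scaleC_of_real) (simp add: field_simps)
    moreover have "M2 ((1 / \<nu>) *\<^sub>R L) = 0"
      using linear_scale[OF bounded_linear.linear[OF M2], of "1 / \<nu>" L] kerL by simp
    ultimately show ?thesis
      by (simp add: solution_iff)
  qed
  \<comment> \<open>If \<nu> = 0 then L = 0, so \<open>v\<close> is orthogonal to the whole kernel
    and no element of it has scalar component 1.\<close>
  moreover have "\<nu> \<noteq> 0" if "mds_solution D jm jF tp M H" for H
  proof
    assume "\<nu> = 0"
    then have "cinner H L = 0"
      by (simp add: \<nu>_def cinner_eq)
    then have "cinner H v = 0"
      using const[of H] that by (simp add: solution_iff)
    then have "cinner v H = 0"
      using cinner_commute[of v H] by simp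
    then show False
      using that by (simp add: solution_iff)
  qed
  ultimately show ?thesis
    using iter(1) unfolding L_def by blast
qed

end
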